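(* Let $G$ be a finite regular partial cube that is not isomorphic to $K_1$ or $K_2$. Then every convex cycle of $G$ is a $4$-cycle if and only if $G$ is isomorphic to a hypercube $Q_k$ for some $k\geqslant 2$.
   Context: All graphs are finite, simple and undirected. The hypercube $Q_n$ has as vertices all 0-1 sequences of length $n$, two being adjacent iff they differ in exactly one position. A subgraph $H$ of $G$ is isometric if $d_H(u,v)=d_G(u,v)$ for all $u,v\in V(H)$, and convex if moreover every shortest $u,v$-path in $G$ (for $u,v\in V(H)$) lies in $H$. A partial cube is a graph isomorphic to an isometric subgraph of some hypercube $Q_n$. A convex cycle is a cycle that is a convex subgraph; an $l$-cycle is a cycle with $l$ edges. A graph is regular if all its vertices have the same degree. *)

theory Defs
  imports Main "HOL-Library.Extended_Nat"
begin

definition simple_graph :: "'a set \<Rightarrow> ('a \<times> 'a) set \<Rightarrow> bool" where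
  "simple_graph V E \<longleftrightarrow> E \<subseteq> V \<times> V \<and> sym E \<and> (\<forall>v. (v, v) \<notin> E)"

definition finite_graph :: "'a set \<Rightarrow> ('a \<times> 'a) set \<Rightarrow> bool" where
  "finite_graph V E \<longleftrightarrow> simple_graph V E \<and> finite V \<and> V \<noteq> {}"

definition is_walk :: "'a set \<Rightarrow> ('a \<times> 'a) set \<Rightarrow> 'a list \<Rightarrow> 'a \<Rightarrow> 'a \<Rightarrow> bool" where
  "is_walk V E p u v \<longleftrightarrow> p \<noteq> [] \<and> hd p = u \<and> last p = v \<and> set p \<subseteq> V \<and>
     (\<forall>i. Suc i < length p \<longrightarrow> (p ! i, p ! Suc i) \<in> E)"

text \<open>Graph distance (infinite if no walk exists).\<close>
definition gdist :: "'a set \<Rightarrow> ('a \<times> 'a) set \<Rightarrow> 'a \<Rightarrow> 'a \<Rightarrow> enat" where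
  "gdist V E u v = (INF p \<in> {p. is_walk V E p u v}. enat (length p - 1))"

text \<open>Shortest u,v-walks (these are automatically paths).\<close>
definition shortest_path :: "'a set \<Rightarrow> ('a \<times> 'a) set \<Rightarrow> 'a list \<Rightarrow> 'a \<Rightarrow> 'a \<Rightarrow> bool" where
  "shortest_path V E p u v \<longleftrightarrow> is_walk V E p u v \<and> enat (length p - 1) = gdist V E u v"

definition subgraph :: "'a set \<Rightarrow> ('a \<times> 'a) set \<Rightarrow> 'a set \<Rightarrow> ('a \<times> 'a) set \<Rightarrow> bool" where
  "subgraph H F V E \<longleftrightarrow> H \<subseteq> V \<and> F \<subseteq> E \<and> F \<subseteq> H \<times> H"

definition isometric_subgraph :: "'a set \<Rightarrow> ('a \<times> 'a) set \<Rightarrow> 'a set \<Rightarrow> ('a \<times> 'a) set \<Rightarrow> bool" where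
  "isometric_subgraph H F V E \<longleftrightarrow> subgraph H F V E \<and>
     (\<forall>u\<in>H. \<forall>v\<in>H. gdist H F u v = gdist V E u v)"

definition convex_subgraph :: "'a set \<Rightarrow> ('a \<times> 'a) set \<Rightarrow> 'a set \<Rightarrow> ('a \<times> 'a) set \<Rightarrow> bool" where
  "convex_subgraph H F V E \<longleftrightarrow> isometric_subgraph H F V E \<and>
     (\<forall>u\<in>H. \<forall>v\<in>H. \<forall>p. shortest_path V E p u v \<longrightarrow>
        set p \<subseteq> H \<and> (\<forall>i. Suc i < length p \<longrightarrow> (p ! i, p ! Suc i) \<in> F))"

definition graph_iso :: "'a set \<Rightarrow> ('a \<times> 'a) set \<Rightarrow> 'b set \<Rightarrow> ('b \<times> 'b) set \<Rightarrow> bool" where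
  "graph_iso V E W D \<longleftrightarrow> (\<exists>f. bij_betw f V W \<and>
     (\<forall>u\<in>V. \<forall>v\<in>V. (u, v) \<in> E \<longleftrightarrow> (f u, f v) \<in> D))"

definition cube_V :: "nat \<Rightarrow> bool list set" where
  "cube_V n = {xs. length xs = n}"

definition cube_E :: "nat \<Rightarrow> (bool list \<times> bool list) set" where
  "cube_E n = {(xs, ys). length xs = n \<and> length ys = n \<and> card {i. i < n \<and> xs ! i \<noteq> ys ! i} = 1}"

definition partial_cube :: "'a set \<Rightarrow> ('a \<times> 'a) set \<Rightarrow> bool" where
  "partial_cube V E \<longleftrightarrow> (\<exists>n H F. isometric_subgraph H F (cube_V n) (cube_E n) \<and> graph_iso V E H F)"

definition cycle_graph :: "'a set \<Rightarrow> ('a \<times> 'a) set \<Rightarrow> nat \<Rightarrow> bool" where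
  "cycle_graph C F l \<longleftrightarrow> 3 \<le> l \<and> (\<exists>c. length c = l \<and> distinct c \<and> C = set c \<and>
     F = {(c ! i, c ! ((i + 1) mod l)) | i. i < l} \<union> {(c ! ((i + 1) mod l), c ! i) | i. i < l})"

definition convex_cycle :: "'a set \<Rightarrow> ('a \<times> 'a) set \<Rightarrow> 'a set \<Rightarrow> ('a \<times> 'a) set \<Rightarrow> nat \<Rightarrow> bool" where
  "convex_cycle V E C F l \<longleftrightarrow> cycle_graph C F l \<and> convex_subgraph C F V E"

definition regular :: "'a set \<Rightarrow> ('a \<times> 'a) set \<Rightarrow> bool" where
  "regular V E \<longleftrightarrow> (\<exists>d. \<forall>v\<in>V. card {u. (v, u) \<in> E} = d)"

definition K_V :: "nat \<Rightarrow> nat set" where "K_V n = {0..<n}"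
definition K_E :: "nat \<Rightarrow> (nat \<times> nat) set" where
  "K_E n = {(i, j). i < n \<and> j < n \<and> i \<noteq> j}"

end

theory Submission
  imports Defs
begin

text \<open>
  View the vertices as sets, adjacent when they differ in one element, the direction of the edge.
  Suppose that all convex cycles are squares.

  Two parallel edges can be moved towards each other across a square: in a closest counterexample the
  interval spanned by the two edges is a convex cycle of length at least 6. It follows that geodesics
  can be extended backwards: if the only edge at \<open>B\<close> that leads towards \<open>T\<close> has direction \<open>c\<close>, and
  the edge from \<open>A\<close> to \<open>B\<close> lies in no square with it, then that edge is the only one at \<open>A\<close> that
  leads towards \<open>T\<close>.

  If the ends of the first edge of the geodesic do not have the same directions, then by regularity
  there is such an \<open>A\<close>, and \<open>A\<close> and \<open>B\<close> do not have the same directions either. So one edge whose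
  ends have different directions yields arbitrarily long geodesics, which is impossible in a finite
  graph. Thus all vertices have the same directions, and the graph is a cube.
\<close>

section \<open>Isometric families of sets\<close>

definition sdiff :: "'b set \<Rightarrow> 'b set \<Rightarrow> 'b set" (infixl \<open>\<triangle>\<close> 70) where
  "A \<triangle> B = sym_diff A B"

lemma in_sdiff [simp]: "x \<in> A \<triangle> B \<longleftrightarrow> (x \<in> A) \<noteq> (x \<in> B)"
  by (auto simp: sdiff_def)

interpretation sdiff: abstract_boolean_algebra_sym_diff "(\<inter>)" "(\<union>)" uminus "{}" UNIV "(\<triangle>)"
  by unfold_locales auto

lemmas sdiff_ac = sdiff.xor.assoc sdiff.xor.commute sdiff.xor.left_commute

lemma sdiff_cancel_right [simp]: "A \<triangle> B \<triangle> B = A"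
  by (simp add: sdiff.xor.assoc)

lemma sdiff_eq_empty_iff [simp]: "A \<triangle> B = {} \<longleftrightarrow> A = B"
  by (auto simp: sdiff_def)

lemma sdiff_left_cancel [simp]: "A \<triangle> B = A \<triangle> C \<longleftrightarrow> B = C"
  by (metis sdiff.xor_left_self)

lemma sdiff_translate [simp]: "(A \<triangle> B) \<triangle> (A \<triangle> C) = B \<triangle> C"
  by (rule set_eqI) auto

lemma finite_sdiff [simp]: "finite A \<Longrightarrow> finite B \<Longrightarrow> finite (A \<triangle> B)"
  by (simp add: sdiff_def)

lemma sdiff_singleton: "A \<triangle> {a} = (if a \<in> A then A - {a} else insert a A)"
  by (auto simp: sdiff_def)

lemma sdiff_step: "a \<in> A \<triangle> B \<Longrightarrow> A \<triangle> {a} \<triangle> B = A \<triangle> B - {a}"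
  by (rule set_eqI) auto

lemma mem_translate_iff [simp]: "Z \<in> (\<triangle>) u ` X \<longleftrightarrow> u \<triangle> Z \<in> X"
  by (metis image_iff sdiff.xor_left_self)

locale isometric_family =
  fixes X :: "'b set set"
  assumes finite_distance: "A \<in> X \<Longrightarrow> B \<in> X \<Longrightarrow> finite (A \<triangle> B)"
    and ex_step: "A \<in> X \<Longrightarrow> B \<in> X \<Longrightarrow> A \<noteq> B \<Longrightarrow> \<exists>a\<in>A \<triangle> B. A \<triangle> {a} \<in> X"
begin

lemma geodesic_induct [consumes 2, case_names endpoint step]:
  assumes "A \<in> X" "B \<in> X"
    and "P B"
    and step: "\<And>A a. A \<in> X \<Longrightarrow> a \<in> A \<triangle> B \<Longrightarrow> A \<triangle> {a} \<in> X \<Longrightarrow> P (A \<triangle> {a}) \<Longrightarrow> P A"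
  shows "P A"
  using \<open>A \<in> X\<close>
proof (induction "card (A \<triangle> B)" arbitrary: A rule: less_induct)
  case less
  show ?case
  proof (cases "A = B")
    case False
    then obtain a where a: "a \<in> A \<triangle> B" "A \<triangle> {a} \<in> X"
      using ex_step less.prems \<open>B \<in> X\<close> by blast
    have "card (A \<triangle> {a} \<triangle> B) < card (A \<triangle> B)"
      unfolding sdiff_step[OF a(1)]
      using a(1) finite_distance[OF less.prems \<open>B \<in> X\<close>] by (intro card_Diff1_less)
    then show ?thesis
      using less a step by blast
  qed (use \<open>P B\<close> in simp)
qed

lemma crossing_edge:
  assumes "A \<in> X" "B \<in> X" "e \<in> A \<triangle> B"
  shows "\<exists>Z\<in>X. Z \<triangle> {e} \<in> X \<and> A \<triangle> Z \<subseteq> A \<triangle> B - {e}"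
  using assms
proof (induction rule: geodesic_induct)
  case (step A a)
  show ?case
  proof (cases "a = e")
    case True
    then show ?thesis
      using step.hyps by (intro bexI[of _ A]) auto
  next
    case False
    then obtain Z where Z: "Z \<in> X" "Z \<triangle> {e} \<in> X" "A \<triangle> {a} \<triangle> Z \<subseteq> A \<triangle> {a} \<triangle> B - {e}"
      using step by auto
    have "A \<triangle> Z \<subseteq> insert a (A \<triangle> {a} \<triangle> Z)"
      by auto
    also have "\<dots> \<subseteq> A \<triangle> B - {e}"
      using Z(3) step.hyps(2) False unfolding sdiff_step[OF step.hyps(2)] by blast
    finally show ?thesis
      using Z by blast
  qed
qed simp

end

lemma isometric_family_Pow:
  assumes "finite S"
  shows "isometric_family (Pow S)"
proof
  fix A B assume AB: "A \<in> Pow S" "B \<in> Pow S"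
  with assms show "finite (A \<triangle> B)"
    by (simp add: finite_subset)
  assume "A \<noteq> B"
  then obtain a where "a \<in> A \<triangle> B"
    by (metis ex_in_conv sdiff_eq_empty_iff)
  with AB show "\<exists>a\<in>A \<triangle> B. A \<triangle> {a} \<in> Pow S"
    by (intro bexI[of _ a]) auto
qed

section \<open>Cycles in families of sets\<close>

text \<open>The closed walk that starts at \<open>{}\<close>, adds the elements of \<open>xs\<close> one by one and then removes
  them in the same order.\<close>

definition cycle_vertex :: "'b list \<Rightarrow> nat \<Rightarrow> 'b set" where
  "cycle_vertex xs t = (if t < length xs then set (take t xs) else set (drop (t - length xs) xs))"

definition cycle_vertices :: "'b list \<Rightarrow> 'b set set" where
  "cycle_vertices xs = cycle_vertex xs ` {..<2 * length xs}"

lemma cycle_vertices_eq: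
  "cycle_vertices xs =
    (\<lambda>i. set (take i xs)) ` {..<length xs} \<union> (\<lambda>i. set (drop i xs)) ` {..<length xs}"
proof -
  let ?m = "length xs"
  have split: "{..<2 * ?m} = {..<?m} \<union> (+) ?m ` {..<?m}"
    by (simp add: lessThan_atLeast0 mult_2 ivl_disj_un_two)
  show ?thesis
    unfolding cycle_vertices_def split image_Un image_image
    by (intro arg_cong2[where f = "(\<union>)"] image_cong) (auto simp: cycle_vertex_def)
qed

lemma cycle_vertices_snoc:
  "cycle_vertices (xs @ [e]) =
    (\<lambda>i. set (take i xs)) ` {..length xs} \<union> insert e ` (\<lambda>i. set (drop i xs)) ` {..length xs}"
  unfolding cycle_vertices_eq length_append_singleton lessThan_Suc_atMost image_image
  by (intro arg_cong2[where f = "(\<union>)"] image_cong) auto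

lemma cycle_vertex_eq_image_nth:
  assumes "t < 2 * length xs"
  shows "cycle_vertex xs t = (!) xs ` {t - length xs..<min t (length xs)}"
proof (cases "t < length xs")
  case True
  then show ?thesis
    by (simp add: cycle_vertex_def nth_image)
next
  case False
  have "set (drop i xs) = (!) xs ` {i..<length xs}" for i
    by (auto simp: drop_eq_nths set_nths)
  with False assms show ?thesis
    by (simp add: cycle_vertex_def)
qed

lemma card_image_sdiff:
  assumes "inj_on f (A \<union> B)"
  shows "card (f ` A \<triangle> f ` B) = card (A \<triangle> B)"
proof -
  have "f ` A \<triangle> f ` B = f ` (A \<triangle> B)"
    using assms by (auto simp: sdiff_def inj_on_def)
  moreover have "inj_on f (A \<triangle> B)"
    using assms by (rule inj_on_subset) auto
  ultimately show ?thesis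
    by (simp add: card_image)
qed

lemma card_window_sdiff:
  fixes m s t :: nat
  assumes "s \<le> t" "t < 2 * m"
  shows "card ({s - m..<min s m} \<triangle> {t - m..<min t m}) = min (t - s) (2 * m - (t - s))"
    (is "card ?W = _")
proof -
  consider (below) "t < m" | (above) "m \<le> s" | (disjoint) "s < m" "m \<le> t" "s \<le> t - m"
    | (overlapping) "s < m" "m \<le> t" "t - m < s"
    by linarith
  then show ?thesis
  proof cases
    case below
    then have "?W = {s..<t}"
      using assms by auto
    with below show ?thesis
      using assms by simp
  next
    case above
    then have "?W = {s - m..<t - m}"
      using assms by auto
    with above show ?thesis
      using assms by simp
  next
    case disjoint
    then have "?W = {0..<s} \<union> {t - m..<m}"
      using assms by auto
    with disjoint show ?thesis
      using assms by (simp add: card_Un_disjoint)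
  next
    case overlapping
    then have "?W = {0..<t - m} \<union> {s..<m}"
      using assms by auto
    with overlapping show ?thesis
      using assms by (simp add: card_Un_disjoint)
  qed
qed

lemma card_cycle_vertex_sdiff:
  assumes "distinct xs" "s \<le> t" "t < 2 * length xs"
  shows "card (cycle_vertex xs s \<triangle> cycle_vertex xs t) = min (t - s) (2 * length xs - (t - s))"
proof -
  have "inj_on ((!) xs) ({s - length xs..<min s (length xs)} \<union> {t - length xs..<min t (length xs)})"
    using assms(1) by (rule inj_on_nth) auto
  then show ?thesis
    using assms by (simp add: cycle_vertex_eq_image_nth card_image_sdiff card_window_sdiff)
qed

lemma cycle_vertex_adjacent_iff:
  assumes "distinct xs" "2 \<le> length xs" "s < 2 * length xs" "t < 2 * length xs"
  shows "card (cycle_vertex xs s \<triangle> cycle_vertex xs t) = 1 \<longleftrightarrow>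
    t = Suc s mod (2 * length xs) \<or> s = Suc t mod (2 * length xs)"
  using assms(3,4)
proof (induction s t rule: linorder_wlog)
  case (le s t)
  then show ?case
    using assms(2) by (auto simp: card_cycle_vertex_sdiff[OF assms(1)] min_def mod_Suc)
next
  case (sym s t)
  then show ?case
    by (simp add: sdiff.xor.commute disj_commute)
qed

lemma inj_on_cycle_vertex:
  assumes "distinct xs"
  shows "inj_on (cycle_vertex xs) {..<2 * length xs}"
proof (rule linorder_inj_onI')
  fix s t assume "s \<in> {..<2 * length xs}" "t \<in> {..<2 * length xs}" "s < t"
  then have "card (cycle_vertex xs s \<triangle> cycle_vertex xs t) \<noteq> 0"
    using card_cycle_vertex_sdiff[OF assms, of s t] by auto
  then show "cycle_vertex xs s \<noteq> cycle_vertex xs t"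
    by auto
qed

definition accessible :: "'b set set \<Rightarrow> bool" where
  "accessible L \<longleftrightarrow> (\<forall>Z\<in>L. Z \<noteq> {} \<longrightarrow> (\<exists>a\<in>Z. Z - {a} \<in> L))"

lemma accessible_prefixes:
  assumes "accessible L" "finite B" "B \<in> L"
  shows "\<exists>xs. distinct xs \<and> set xs = B \<and> (\<forall>i. set (take i xs) \<in> L)"
  using assms(2,3)
proof (induction B rule: finite_psubset_induct)
  case (psubset B)
  show ?case
  proof (cases "B = {}")
    case True
    then show ?thesis
      using psubset.prems by simp
  next
    case False
    then obtain a where a: "a \<in> B" "B - {a} \<in> L"
      using assms(1) psubset.prems by (auto simp: accessible_def)
    then obtain xs where xs: "distinct xs" "set xs = B - {a}" "\<And>i. set (take i xs) \<in> L"
      using psubset.IH[of "B - {a}"] by blast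
    have "set (xs @ [a]) = B"
      using xs(2) a(1) by auto
    moreover have "set (take i (xs @ [a])) \<in> L" for i
    proof (cases "i \<le> length xs")
      case False
      then have "take i (xs @ [a]) = xs @ [a]"
        by simp
      then show ?thesis
        using \<open>set (xs @ [a]) = B\<close> psubset.prems by simp
    qed (use xs(3) in simp)
    ultimately show ?thesis
      using xs(1,2) by (intro exI[of _ "xs @ [a]"]) simp
  qed
qed

lemma accessible_complement:
  assumes "accessible H" "finite B" "B \<in> H" "Z \<subseteq> B"
    and cross: "\<And>Y. Y \<in> H \<Longrightarrow> Y \<subseteq> B \<Longrightarrow> Z \<inter> Y = {} \<or> Z \<union> Y = B"
  shows "B - Z \<in> H"
proof -
  obtain ys where ys: "distinct ys" "set ys = B" "\<And>i. set (take i ys) \<in> H"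
    using accessible_prefixes[OF assms(1-3)] by blast
  define Y where "Y = set (take (card B - card Z) ys)"
  have Y_subset: "Y \<subseteq> B"
    using ys(2) set_take_subset by (metis Y_def)
  have "card B = length ys"
    using ys(1,2) distinct_card by metis
  then have "card Y = card B - card Z"
    using ys(1) by (simp add: Y_def distinct_card)
  then have card_YZ: "card Y + card Z = card B"
    using card_mono[OF \<open>finite B\<close> \<open>Z \<subseteq> B\<close>] by simp
  have fin: "finite Y" "finite Z"
    using Y_subset assms finite_subset by blast+
  have "Y = B - Z"
    using cross[of Y]
  proof
    assume "Z \<inter> Y = {}"
    then have "card (Y \<union> Z) = card B"
      using fin card_YZ by (simp add: card_Un_disjoint Int_commute)
    then have "Y \<union> Z = B"
      using assms Y_subset by (intro card_subset_eq) auto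
    with \<open>Z \<inter> Y = {}\<close> show ?thesis
      by blast
  next
    assume "Z \<union> Y = B"
    then have "card (Y \<inter> Z) = 0"
      using card_Un_Int[OF fin] card_YZ by (simp add: Un_commute)
    with fin \<open>Z \<union> Y = B\<close> show ?thesis
      by auto
  qed (use ys(3) Y_subset in \<open>auto simp: Y_def\<close>)
  then show ?thesis
    using ys(3) by (metis Y_def)
qed

lemma set_drop_distinct:
  assumes "distinct xs"
  shows "set (drop i xs) = set xs - set (take i xs)"
proof -
  have "set xs = set (take i xs) \<union> set (drop i xs)"
    by (metis append_take_drop_id set_append)
  then show ?thesis
    using set_take_disj_set_drop_if_distinct[OF assms, of i i] by auto
qed

lemma accessible_chain_eq_prefixes:
  assumes "accessible L" "finite B" "B \<in> L" "L \<subseteq> Pow B"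
    and chain: "\<And>Y Z. Y \<in> L \<Longrightarrow> Z \<in> L \<Longrightarrow> Y \<subseteq> Z \<or> Z \<subseteq> Y"
  shows "\<exists>xs. distinct xs \<and> set xs = B \<and> L = (\<lambda>i. set (take i xs)) ` {..length xs}"
proof -
  obtain xs where xs: "distinct xs" "set xs = B" "\<And>i. set (take i xs) \<in> L"
    using accessible_prefixes[OF assms(1-3)] by blast
  have prefix: "Y = set (take (card Y) xs)" "card Y \<le> length xs" if "Y \<in> L" for Y
  proof -
    have "Y \<subseteq> B"
      using that \<open>L \<subseteq> Pow B\<close> by blast
    then have "finite Y"
      using \<open>finite B\<close> by (rule finite_subset)
    show len: "card Y \<le> length xs"
      using card_mono[OF \<open>finite B\<close> \<open>Y \<subseteq> B\<close>] distinct_card[OF xs(1)] xs(2) by simp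
    have "card (set (take (card Y) xs)) = card Y"
      using len xs(1) by (simp add: distinct_card)
    with chain[OF that xs(3)[of "card Y"]] show "Y = set (take (card Y) xs)"
      using card_subset_eq[OF \<open>finite Y\<close>] card_subset_eq[of "set (take (card Y) xs)" Y] by auto
  qed
  have "L = (\<lambda>i. set (take i xs)) ` {..length xs}"
  proof
    show "L \<subseteq> (\<lambda>i. set (take i xs)) ` {..length xs}"
    proof
      fix Y assume "Y \<in> L"
      from prefix[OF this] show "Y \<in> (\<lambda>i. set (take i xs)) ` {..length xs}"
        by (intro image_eqI[of _ _ "card Y"]) auto
    qed
  qed (use xs(3) in auto)
  with xs(1,2) show ?thesis
    by blast
qed

lemma complementary_chains:
  assumes "finite B" and sub: "L \<subseteq> Pow B" "H \<subseteq> Pow B"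
    and acc: "accessible L" "accessible H" and top: "B \<in> L" "B \<in> H"
    and disjoint_or_cover: "\<And>Y Z. Y \<in> L \<Longrightarrow> Z \<in> H \<Longrightarrow> Y \<inter> Z = {} \<or> Y \<union> Z = B"
  shows "\<exists>xs. distinct xs \<and> set xs = B \<and> L = (\<lambda>i. set (take i xs)) ` {..length xs} \<and>
    H = (\<lambda>i. set (drop i xs)) ` {..length xs}"
proof -
  have compl_H: "B - Y \<in> H" if "Y \<in> L" for Y
  proof (rule accessible_complement[OF acc(2) \<open>finite B\<close> top(2)])
    show "Y \<inter> Z = {} \<or> Y \<union> Z = B" if "Z \<in> H" for Z
      using disjoint_or_cover[OF \<open>Y \<in> L\<close> that] .
  qed (use that sub in auto)
  have compl_L: "B - Z \<in> L" if "Z \<in> H" for Z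
  proof (rule accessible_complement[OF acc(1) \<open>finite B\<close> top(1)])
    show "Z \<inter> Y = {} \<or> Z \<union> Y = B" if "Y \<in> L" for Y
      using disjoint_or_cover[OF that \<open>Z \<in> H\<close>] by (simp add: Int_commute Un_commute)
  qed (use that sub in auto)
  have "Y \<subseteq> Z \<or> Z \<subseteq> Y" if "Y \<in> L" "Z \<in> L" for Y Z
    using disjoint_or_cover[OF \<open>Y \<in> L\<close> compl_H[OF \<open>Z \<in> L\<close>]] that sub(1) by blast
  then obtain xs where xs: "distinct xs" "set xs = B"
    and L_eq: "L = (\<lambda>i. set (take i xs)) ` {..length xs}"
    using accessible_chain_eq_prefixes[OF acc(1) \<open>finite B\<close> top(1) sub(1)] by blast
  have "H = (-) B ` L"
  proof
    show "H \<subseteq> (-) B ` L"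
    proof
      fix Z assume "Z \<in> H"
      with sub(2) show "Z \<in> (-) B ` L"
        by (intro image_eqI[of _ _ "B - Z"] compl_L) auto
    qed
  qed (use compl_H in auto)
  then have "H = (\<lambda>i. set (drop i xs)) ` {..length xs}"
    unfolding L_eq image_image using xs by (simp add: set_drop_distinct)
  with xs L_eq show ?thesis
    by blast
qed

text \<open>The members of \<open>X\<close> in the subcube spanned by \<open>S\<close> at \<open>A\<close>, given by their differences from \<open>A\<close>.\<close>

definition face :: "'b set set \<Rightarrow> 'b set \<Rightarrow> 'b set \<Rightarrow> 'b set set" where
  "face X A S = {Z. Z \<subseteq> S \<and> A \<triangle> Z \<in> X}"

lemma face_insert:
  assumes "e \<notin> B"
  shows "face X A (insert e B) = face X A B \<union> insert e ` face X (A \<triangle> {e}) B"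
proof -
  have "face X A (insert e B) = {Z \<in> Pow (insert e B). A \<triangle> Z \<in> X}"
    by (simp add: face_def)
  also have "\<dots> = {Z \<in> Pow B. A \<triangle> Z \<in> X} \<union> insert e ` {Z \<in> Pow B. A \<triangle> insert e Z \<in> X}"
    unfolding Pow_insert by blast
  also have "{Z \<in> Pow B. A \<triangle> insert e Z \<in> X} = face X (A \<triangle> {e}) B"
  proof -
    have "A \<triangle> insert e Z = A \<triangle> {e} \<triangle> Z" if "Z \<subseteq> B" for Z
      using that assms by (intro set_eqI) auto
    then show ?thesis
      unfolding face_def by (metis Pow_iff)
  qed
  finally show ?thesis
    by (simp add: face_def)
qed

context isometric_family
begin

lemma accessible_face:
  assumes "A \<in> X"
  shows "accessible (face X A S)"
  unfolding accessible_def
proof (intro ballI impI)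
  fix Z assume Z: "Z \<in> face X A S" "Z \<noteq> {}"
  then have "A \<triangle> Z \<in> X" "A \<triangle> Z \<noteq> A"
    using sdiff_left_cancel[of A Z "{}"] by (simp_all add: face_def)
  then obtain a where "a \<in> A \<triangle> Z \<triangle> A" "A \<triangle> Z \<triangle> {a} \<in> X"
    using ex_step assms by blast
  moreover from this have "a \<in> Z"
    by auto
  moreover from this have "Z \<triangle> {a} = Z - {a}"
    by (simp add: sdiff_singleton)
  ultimately show "\<exists>a\<in>Z. Z - {a} \<in> face X A S"
    using Z(1) by (auto simp: face_def sdiff.xor.assoc simp del: in_sdiff)
qed

text \<open>A geodesic from \<open>A \<triangle> Y\<close> to \<open>A \<triangle> {e} \<triangle> Z\<close> crosses the direction \<open>e\<close> at \<open>A\<close> or at \<open>A \<triangle> B\<close>.\<close>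

lemma face_disjoint_or_cover:
  assumes "e \<notin> B" and no_edge_between: "face X A B \<inter> face X (A \<triangle> {e}) B \<subseteq> {{}, B}"
    and Y: "Y \<in> face X A B" and Z: "Z \<in> face X (A \<triangle> {e}) B"
  shows "Y \<inter> Z = {} \<or> Y \<union> Z = B"
proof -
  have "Y \<subseteq> B" "Z \<subseteq> B"
    using Y Z by (simp_all add: face_def)
  then have "e \<in> (A \<triangle> Y) \<triangle> (A \<triangle> {e} \<triangle> Z)"
    using \<open>e \<notin> B\<close> by auto
  then obtain W where W: "W \<in> X" "W \<triangle> {e} \<in> X"
    "A \<triangle> Y \<triangle> W \<subseteq> (A \<triangle> Y) \<triangle> (A \<triangle> {e} \<triangle> Z) - {e}"
    using crossing_edge[of "A \<triangle> Y" "A \<triangle> {e} \<triangle> Z" e] Y Z by (auto simp: face_def simp del: in_sdiff)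
  have "(A \<triangle> Y) \<triangle> (A \<triangle> {e} \<triangle> Z) - {e} = Y \<triangle> Z"
    using \<open>Y \<subseteq> B\<close> \<open>Z \<subseteq> B\<close> \<open>e \<notin> B\<close> by auto
  moreover have "A \<triangle> Y \<triangle> W = Y \<triangle> (A \<triangle> W)"
    by (simp only: sdiff_ac)
  ultimately have between: "Y \<triangle> (A \<triangle> W) \<subseteq> Y \<triangle> Z"
    using W(3) by simp
  have "A \<triangle> W \<subseteq> Y \<union> Y \<triangle> (A \<triangle> W)"
    by auto
  also have "\<dots> \<subseteq> Y \<union> Y \<triangle> Z"
    using between by blast
  also have "\<dots> \<subseteq> B"
    using \<open>Y \<subseteq> B\<close> \<open>Z \<subseteq> B\<close> by auto
  finally have "A \<triangle> W \<in> face X A B \<inter> face X (A \<triangle> {e}) B"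
    using W(1,2) by (simp add: face_def sdiff_ac)
  then have "A \<triangle> W = {} \<or> A \<triangle> W = B"
    using no_edge_between by blast
  with between \<open>Y \<subseteq> B\<close> \<open>Z \<subseteq> B\<close> show ?thesis
    by (elim disjE) (simp, auto)
qed

lemma face_between_parallel_edges:
  assumes "e \<notin> B" and edges: "face X A B \<inter> face X (A \<triangle> {e}) B = {{}, B}"
  shows "\<exists>xs. distinct xs \<and> set xs = insert e B \<and> face X A (insert e B) = cycle_vertices xs"
proof -
  have ends: "{} \<in> face X A B" "{} \<in> face X (A \<triangle> {e}) B" "B \<in> face X A B" "B \<in> face X (A \<triangle> {e}) B"
    using edges by blast+
  then have "A \<in> X" "A \<triangle> {e} \<in> X" "A \<triangle> B \<in> X"
    by (simp_all add: face_def)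
  then have "finite B"
    using finite_distance[of A "A \<triangle> B"] by simp
  have face_subset: "face X A' B \<subseteq> Pow B" for A'
    by (auto simp: face_def)
  obtain xs where xs: "distinct xs" "set xs = B"
    "face X A B = (\<lambda>i. set (take i xs)) ` {..length xs}"
    "face X (A \<triangle> {e}) B = (\<lambda>i. set (drop i xs)) ` {..length xs}"
    using complementary_chains[OF \<open>finite B\<close> face_subset face_subset
        accessible_face[OF \<open>A \<in> X\<close>] accessible_face[OF \<open>A \<triangle> {e} \<in> X\<close>] ends(3,4)
        face_disjoint_or_cover[OF \<open>e \<notin> B\<close> eq_refl[OF edges]]] by blast
  have "face X A (insert e B) = cycle_vertices (xs @ [e])"
    unfolding face_insert[OF \<open>e \<notin> B\<close>] cycle_vertices_snoc xs(3,4) ..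
  with xs(1,2) \<open>e \<notin> B\<close> show ?thesis
    by (intro exI[of _ "xs @ [e]"]) simp
qed

end

section \<open>Families without long convex cycles\<close>

definition directions :: "'b set set \<Rightarrow> 'b set \<Rightarrow> 'b set" where
  "directions X A = {a. A \<triangle> {a} \<in> X}"

lemma finite_directions:
  assumes "finite X"
  shows "finite (directions X A)"
proof -
  have "inj_on (\<lambda>a. A \<triangle> {a}) (directions X A)"
    by (auto simp: inj_on_def)
  then show ?thesis
    by (rule inj_on_finite) (use assms in \<open>auto simp: directions_def\<close>)
qed

locale long_cycle_free = isometric_family +
  assumes face_cycle_short:
    "A \<in> X \<Longrightarrow> distinct xs \<Longrightarrow> face X A (set xs) = cycle_vertices xs \<Longrightarrow> length xs \<le> 2"
begin

lemma card_eq_1_if_no_edge_between: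
  assumes "e \<notin> B" "B \<noteq> {}" and edges: "face X A B \<inter> face X (A \<triangle> {e}) B = {{}, B}"
  shows "card B = 1"
proof -
  have "{} \<in> face X A B" "B \<in> face X A B"
    using edges by blast+
  then have "A \<in> X" "A \<triangle> B \<in> X"
    by (simp_all add: face_def)
  then have "finite B"
    using finite_distance[of A "A \<triangle> B"] by simp
  obtain xs where xs: "distinct xs" "set xs = insert e B"
    "face X A (insert e B) = cycle_vertices xs"
    using face_between_parallel_edges[OF \<open>e \<notin> B\<close> edges] by blast
  have "length xs = Suc (card B)"
    using distinct_card[OF xs(1)] \<open>finite B\<close> \<open>e \<notin> B\<close> by (simp add: xs(2))
  moreover have "length xs \<le> 2"
    using face_cycle_short[OF \<open>A \<in> X\<close> xs(1)] xs(2,3) by simp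
  moreover have "card B \<noteq> 0"
    using \<open>finite B\<close> \<open>B \<noteq> {}\<close> by simp
  ultimately show ?thesis
    by linarith
qed

lemma parallel_edge_step:
  assumes "A \<in> X" "e \<in> directions X A"
    and "C \<in> X" "e \<in> directions X C" "A \<noteq> C" "e \<notin> A \<triangle> C"
  shows "\<exists>a\<in>A \<triangle> C. a \<in> directions X A \<and> e \<in> directions X (A \<triangle> {a})"
  using assms(3-)
proof (induction "card (A \<triangle> C)" arbitrary: C rule: less_induct)
  case less
  let ?B = "A \<triangle> C"
  let ?edges = "face X A ?B \<inter> face X (A \<triangle> {e}) ?B"
  have fin: "finite ?B"
    using \<open>A \<in> X\<close> \<open>C \<in> X\<close> by (rule finite_distance)
  show ?case
  proof (cases "?edges \<subseteq> {{}, ?B}")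
    case True
    have "A \<triangle> {e} \<triangle> ?B = C \<triangle> {e}"
      by (simp add: sdiff_ac)
    then have "{{}, ?B} \<subseteq> ?edges"
      using assms(1,2) less.prems(1,2) by (simp add: face_def directions_def)
    with True have "?edges = {{}, ?B}"
      by (rule equalityI)
    moreover have "?B \<noteq> {}"
      using \<open>A \<noteq> C\<close> by simp
    ultimately have "card ?B = 1"
      using card_eq_1_if_no_edge_between less.prems(4) by metis
    then obtain a where a: "?B = {a}"
      by (rule card_1_singletonE)
    then have "A \<triangle> {a} = C"
      by (metis sdiff.xor_left_self)
    with a less.prems show ?thesis
      by (simp add: directions_def)
  next
    case False
    then obtain Z where Z: "Z \<noteq> {}" "Z \<subset> ?B" "A \<triangle> Z \<in> X" "A \<triangle> {e} \<triangle> Z \<in> X"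
      unfolding face_def by blast
    have "card Z < card ?B"
      using fin Z(2) by (rule psubset_card_mono)
    moreover have "A \<triangle> Z \<triangle> {e} = A \<triangle> {e} \<triangle> Z"
      by (simp only: sdiff_ac)
    then have "e \<in> directions X (A \<triangle> Z)"
      using Z(4) by (simp add: directions_def)
    moreover have "A \<noteq> A \<triangle> Z"
      using Z(1) by (metis sdiff.xor.right_neutral sdiff_left_cancel)
    moreover have "e \<notin> Z"
      using Z(2) less.prems(4) by blast
    ultimately have "\<exists>a\<in>Z. a \<in> directions X A \<and> e \<in> directions X (A \<triangle> {a})"
      using less.hyps[of "A \<triangle> Z"] Z(3) by simp
    with Z(2) show ?thesis
      by blast
  qed
qed

lemma two_directions_square:
  assumes "A \<in> X" "T \<in> X"
    and e: "e \<in> directions X A" "e \<in> A \<triangle> T" and b: "b \<in> directions X A" "b \<in> A \<triangle> T" and "b \<noteq> e"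
  shows "\<exists>a\<in>A \<triangle> {e} \<triangle> T. a \<in> directions X (A \<triangle> {e}) \<and> a \<in> directions X A"
proof -
  have "A \<triangle> {b} \<in> X" "e \<in> A \<triangle> {b} \<triangle> T"
    using b(1) e(2) \<open>b \<noteq> e\<close> by (auto simp: directions_def)
  then obtain Z where Z: "Z \<in> X" "Z \<triangle> {e} \<in> X" "A \<triangle> {b} \<triangle> Z \<subseteq> A \<triangle> {b} \<triangle> T - {e}"
    using crossing_edge \<open>T \<in> X\<close> by blast
  have "A \<triangle> Z \<subseteq> insert b (A \<triangle> {b} \<triangle> Z)"
    by auto
  also have "\<dots> \<subseteq> A \<triangle> T - {e}"
    using Z(3) b(2) \<open>b \<noteq> e\<close> unfolding sdiff_step[OF b(2)] by blast
  also have "\<dots> = A \<triangle> {e} \<triangle> T"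
    by (rule sdiff_step[OF e(2), symmetric])
  finally have between: "A \<triangle> Z \<subseteq> A \<triangle> {e} \<triangle> T" .
  have "b \<in> A \<triangle> Z"
    using Z(3) b(2) by auto
  then have "A \<triangle> {e} \<noteq> Z \<triangle> {e}"
    by (metis empty_iff sdiff.xor_self sdiff_cancel_right)
  moreover have translate: "(A \<triangle> {e}) \<triangle> (Z \<triangle> {e}) = A \<triangle> Z"
    by (rule set_eqI) auto
  moreover have "e \<notin> A \<triangle> Z"
    using between e(2) by auto
  ultimately obtain a where "a \<in> A \<triangle> Z" "a \<in> directions X (A \<triangle> {e})"
    "e \<in> directions X (A \<triangle> {e} \<triangle> {a})"
    using parallel_edge_step[of "A \<triangle> {e}" e "Z \<triangle> {e}"] assms(1) e(1) Z(1,2)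
    unfolding translate by (auto simp: directions_def simp del: in_sdiff)
  moreover from this have "a \<in> directions X A"
    by (simp add: directions_def sdiff_ac)
  ultimately show ?thesis
    using between by blast
qed

lemma geodesic_extend:
  assumes "A \<in> X" "T \<in> X" "e \<in> directions X A"
    and first: "directions X (A \<triangle> {e}) \<inter> (A \<triangle> {e} \<triangle> T) = {c}"
    and no_square: "c \<notin> directions X A"
  shows "card (A \<triangle> T) = Suc (card (A \<triangle> {e} \<triangle> T))" "directions X A \<inter> (A \<triangle> T) = {e}"
proof -
  have "A \<triangle> {e} \<in> X" "e \<in> directions X (A \<triangle> {e})" "e \<noteq> c"
    using assms(1,3) no_square by (auto simp: directions_def)
  then have "e \<notin> A \<triangle> {e} \<triangle> T"
    using first by blast
  then have e_towards: "e \<in> A \<triangle> T"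
    by simp
  show "card (A \<triangle> T) = Suc (card (A \<triangle> {e} \<triangle> T))"
    unfolding sdiff_step[OF e_towards] using finite_distance[OF \<open>A \<in> X\<close> \<open>T \<in> X\<close>] e_towards
    by (rule card_Suc_Diff1[symmetric])
  have "b = e" if b: "b \<in> directions X A" "b \<in> A \<triangle> T" for b
  proof (rule ccontr)
    assume "b \<noteq> e"
    then obtain a where "a \<in> directions X (A \<triangle> {e}) \<inter> (A \<triangle> {e} \<triangle> T)" "a \<in> directions X A"
      using two_directions_square[OF assms(1-3) e_towards b] by blast
    with no_square show False
      unfolding first by blast
  qed
  with assms(3) e_towards show "directions X A \<inter> (A \<triangle> T) = {e}"
    by blast
qed

end

locale regular_long_cycle_free = long_cycle_free +
  fixes d :: nat
  assumes finite_family: "finite X"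
    and regular_family: "A \<in> X \<Longrightarrow> card (directions X A) = d"
begin

lemma directions_not_subset:
  assumes "A \<in> X" "B \<in> X" "directions X A \<noteq> directions X B"
  shows "\<not> directions X A \<subseteq> directions X B"
  using assms regular_family card_subset_eq[OF finite_directions[OF finite_family]] by metis

lemma long_geodesic:
  assumes "A \<in> X" "c \<in> directions X A" "directions X (A \<triangle> {c}) \<noteq> directions X A"
  shows "\<exists>A\<in>X. \<exists>T\<in>X. \<exists>c\<in>directions X A. directions X (A \<triangle> {c}) \<noteq> directions X A \<and>
    directions X A \<inter> (A \<triangle> T) = {c} \<and> card (A \<triangle> T) = Suc k"
proof (induction k)
  case 0
  have "A \<triangle> {c} \<in> X" "directions X A \<inter> (A \<triangle> (A \<triangle> {c})) = {c}" "card (A \<triangle> (A \<triangle> {c})) = Suc 0"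
    using assms(2) by (simp_all add: directions_def)
  with assms show ?case
    by blast
next
  case (Suc k)
  then obtain B T c where B: "B \<in> X" "T \<in> X" "c \<in> directions X B"
    "directions X (B \<triangle> {c}) \<noteq> directions X B"
    and geodesic: "directions X B \<inter> (B \<triangle> T) = {c}" "card (B \<triangle> T) = Suc k"
    by blast
  then have "\<not> directions X B \<subseteq> directions X (B \<triangle> {c})"
    by (intro directions_not_subset) (simp_all add: directions_def)
  then obtain e where e: "e \<in> directions X B" "e \<notin> directions X (B \<triangle> {c})"
    by blast
  define A where "A = B \<triangle> {e}"
  have A: "A \<in> X" "A \<triangle> {e} = B" "e \<in> directions X A"
    using B(1) e(1) by (simp_all add: A_def directions_def)
  have "c \<notin> directions X A"
    using e(2) by (simp add: A_def directions_def sdiff_ac)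
  then have "card (A \<triangle> T) = Suc (Suc k)" "directions X A \<inter> (A \<triangle> T) = {e}"
    using geodesic_extend[OF A(1) B(2) A(3)] A(2) geodesic by simp_all
  moreover have "directions X (A \<triangle> {e}) \<noteq> directions X A"
    using A(2) B(3) \<open>c \<notin> directions X A\<close> by metis
  ultimately show ?case
    using A B(2) by blast
qed

lemma directions_step:
  assumes "A \<in> X" "c \<in> directions X A"
  shows "directions X (A \<triangle> {c}) = directions X A"
proof (rule ccontr)
  assume "directions X (A \<triangle> {c}) \<noteq> directions X A"
  note long = long_geodesic[OF assms this]
  have "Suc k \<in> (\<lambda>(A, T). card (A \<triangle> T)) ` (X \<times> X)" for k
  proof -
    obtain A T where "A \<in> X" "T \<in> X" "card (A \<triangle> T) = Suc k"
      using long[of k] by blast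
    then show ?thesis
      by (intro image_eqI[of _ _ "(A, T)"]) simp_all
  qed
  then have "range Suc \<subseteq> (\<lambda>(A, T). card (A \<triangle> T)) ` (X \<times> X)"
    by (rule image_subsetI)
  then have "finite (range Suc)"
    by (rule finite_subset) (simp add: finite_family)
  then show False
    by (simp add: finite_image_iff)
qed

lemma directions_eq:
  assumes "A \<in> X" "B \<in> X"
  shows "directions X A = directions X B"
  using assms
proof (induction rule: geodesic_induct)
  case (step A a)
  then have "a \<in> directions X A"
    by (simp add: directions_def)
  with step show ?case
    using directions_step by metis
qed simp

lemma family_eq_translated_Pow:
  assumes "C \<in> X"
  shows "X = (\<triangle>) C ` Pow (directions X C)"
proof
  have "C \<triangle> A \<subseteq> directions X C" if "A \<in> X" for A
    using that assms
  proof (induction rule: geodesic_induct)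
    case (step A a)
    have "a \<in> directions X C"
      using step.hyps directions_eq[OF step.hyps(1) assms] by (auto simp: directions_def)
    moreover have "C \<triangle> A \<subseteq> insert a (C \<triangle> (A \<triangle> {a}))"
      by auto
    ultimately show ?case
      using step.IH by blast
  qed simp
  then show "X \<subseteq> (\<triangle>) C ` Pow (directions X C)"
    by (intro subsetI) (simp only: mem_translate_iff Pow_iff)
  have "C \<triangle> Z \<in> X" if "finite Z" "Z \<subseteq> directions X C" for Z
    using that
  proof (induction Z rule: finite_induct)
    case (insert a Z)
    then have "a \<in> directions X (C \<triangle> Z)"
      using directions_eq[of "C \<triangle> Z" C] assms by auto
    moreover have "insert a Z = Z \<triangle> {a}"
      using insert.hyps by (simp add: sdiff_singleton)
    ultimately show ?case
      by (simp add: directions_def sdiff.xor.assoc)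
  qed (use assms in simp)
  then show "(\<triangle>) C ` Pow (directions X C) \<subseteq> X"
    using finite_directions[OF finite_family] finite_subset by blast
qed

end

section \<open>Distances in graphs\<close>

lemma is_walk_singleton [simp]: "is_walk V E [w] u v \<longleftrightarrow> w = u \<and> w = v \<and> w \<in> V"
  by (auto simp: is_walk_def)

lemma is_walk_Cons_Cons [simp]:
  "is_walk V E (w # x # p) u v \<longleftrightarrow> w = u \<and> w \<in> V \<and> (w, x) \<in> E \<and> is_walk V E (x # p) x v"
  by (auto simp: is_walk_def nth_Cons split: nat.splits)

lemma is_walk_ends:
  assumes "is_walk V E p u v"
  shows "p ! 0 = u" "p ! (length p - 1) = v"
  using assms by (auto simp: is_walk_def hd_conv_nth last_conv_nth)

lemma gdist_le_iff:
  "gdist V E u v \<le> enat k \<longleftrightarrow> (\<exists>p. is_walk V E p u v \<and> length p \<le> Suc k)"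
proof
  let ?D = "(\<lambda>p. enat (length p - 1)) ` {p. is_walk V E p u v}"
  assume gdist_le: "gdist V E u v \<le> enat k"
  then have "?D \<noteq> {}"
    unfolding gdist_def by (metis Inf_enat_def enat_ord_simps(5) infinity_ileE)
  then have "gdist V E u v \<in> ?D"
    unfolding gdist_def by (metis LeastI_ex Inf_enat_def ex_in_conv)
  with gdist_le show "\<exists>p. is_walk V E p u v \<and> length p \<le> Suc k"
    by auto
next
  assume "\<exists>p. is_walk V E p u v \<and> length p \<le> Suc k"
  then obtain p where "is_walk V E p u v" "length p \<le> Suc k"
    by blast
  then show "gdist V E u v \<le> enat k"
    unfolding gdist_def by (intro INF_lower2[of p]) auto
qed

lemma gdist_le_Suc:
  assumes "gdist V E u v \<le> enat (Suc k)" "u \<noteq> v"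
  shows "\<exists>w\<in>V. (u, w) \<in> E \<and> gdist V E w v \<le> enat k"
proof -
  obtain p where p: "is_walk V E p u v" "length p \<le> Suc (Suc k)"
    using assms(1) unfolding gdist_le_iff by blast
  then obtain q where q: "p = u # q"
    by (cases p) (simp_all add: is_walk_def)
  with p \<open>u \<noteq> v\<close> obtain w r where "q = w # r"
    by (cases q) auto
  with p q have walk: "is_walk V E (w # r) w v" and "(u, w) \<in> E" "length (w # r) \<le> Suc k"
    by simp_all
  from walk have "w \<in> V"
    by (simp add: is_walk_def)
  moreover have "gdist V E w v \<le> enat k"
    unfolding gdist_le_iff using walk \<open>length (w # r) \<le> Suc k\<close> by blast
  ultimately show ?thesis
    using \<open>(u, w) \<in> E\<close> by blast
qed

lemma gdist_le_1_iff:
  assumes "u \<in> V" "v \<in> V" "u \<noteq> v"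
  shows "gdist V E u v \<le> 1 \<longleftrightarrow> (u, v) \<in> E"
proof
  assume "gdist V E u v \<le> 1"
  then obtain w where w: "(u, w) \<in> E" "gdist V E w v \<le> enat 0"
    using gdist_le_Suc[of V E u v 0] \<open>u \<noteq> v\<close> by (auto simp: one_enat_def)
  then obtain p where "is_walk V E p w v" "length p \<le> 1"
    using gdist_le_iff[of V E w v 0] by auto
  then have "w = v"
    by (cases p) (auto simp: is_walk_def)
  with w show "(u, v) \<in> E"
    by simp
next
  assume "(u, v) \<in> E"
  with assms have "is_walk V E [u, v] u v"
    by simp
  then show "gdist V E u v \<le> 1"
    unfolding one_enat_def gdist_le_iff by (intro exI[of _ "[u, v]"]) simp
qed

lemma gdist_subgraph_ge:
  assumes "subgraph H F V E"
  shows "gdist V E u v \<le> gdist H F u v"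
  unfolding gdist_def
  by (rule INF_superset_mono) (use assms in \<open>auto simp: subgraph_def is_walk_def\<close>)

lemma isometric_subgraph_induced:
  assumes isometric: "isometric_subgraph H F V E" and loopless: "\<And>v. (v, v) \<notin> E"
  shows "F = E \<inter> H \<times> H"
proof -
  have "H \<subseteq> V" "F \<subseteq> E" "F \<subseteq> H \<times> H"
    using isometric by (auto simp: isometric_subgraph_def subgraph_def)
  moreover have "(u, v) \<in> F" if "(u, v) \<in> E" "u \<in> H" "v \<in> H" for u v
  proof -
    have "u \<in> V" "v \<in> V" "u \<noteq> v"
      using that loopless \<open>H \<subseteq> V\<close> by auto
    then have "gdist V E u v \<le> 1"
      using that(1) by (simp add: gdist_le_1_iff)
    then have "gdist H F u v \<le> 1"
      using isometric that(2,3) by (simp add: isometric_subgraph_def)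
    then show ?thesis
      using that(2,3) \<open>u \<noteq> v\<close> by (simp add: gdist_le_1_iff)
  qed
  ultimately show ?thesis
    by auto
qed

lemma convex_subgraph_common_neighbour:
  assumes convex: "convex_subgraph C F V E" and in_C: "x \<in> C" "z \<in> C"
    and "x \<noteq> z" "(x, z) \<notin> E" and w: "w \<in> V" "(x, w) \<in> E" "(w, z) \<in> E"
  shows "(x, w) \<in> F" "(w, z) \<in> F"
proof -
  have "x \<in> V" "z \<in> V"
    using convex in_C by (auto simp: convex_subgraph_def isometric_subgraph_def subgraph_def)
  then have walk: "is_walk V E [x, w, z] x z"
    using w by simp
  then have "gdist V E x z \<le> enat 2"
    unfolding gdist_le_iff by (intro exI[of _ "[x, w, z]"]) simp
  moreover have "\<not> gdist V E x z \<le> 1"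
    using \<open>x \<in> V\<close> \<open>z \<in> V\<close> assms(4,5) by (simp add: gdist_le_1_iff)
  ultimately have "gdist V E x z = enat 2"
    by (cases "gdist V E x z") (auto simp: one_enat_def)
  with walk have "shortest_path V E [x, w, z] x z"
    by (simp add: shortest_path_def)
  then have "\<forall>i. Suc i < length [x, w, z] \<longrightarrow> ([x, w, z] ! i, [x, w, z] ! Suc i) \<in> F"
    using convex in_C unfolding convex_subgraph_def by blast
  from spec[OF this, of 0] spec[OF this, of 1] show "(x, w) \<in> F" "(w, z) \<in> F"
    by simp_all
qed

section \<open>Graphs labelled by sets\<close>

lemma sdiff_card_triangle:
  assumes "finite (A \<triangle> B)" "finite (B \<triangle> C)"
  shows "card (A \<triangle> C) \<le> card (A \<triangle> B) + card (B \<triangle> C)"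
proof -
  have "card (A \<triangle> C) \<le> card ((A \<triangle> B) \<union> (B \<triangle> C))"
    using assms by (intro card_mono) auto
  then show ?thesis
    using card_Un_le[of "A \<triangle> B" "B \<triangle> C"] by linarith
qed

lemma sdiff_subset_if_between:
  assumes "finite (A \<triangle> B)" "finite (B \<triangle> C)"
    and "card (A \<triangle> B) + card (B \<triangle> C) \<le> card (A \<triangle> C)"
  shows "A \<triangle> B \<subseteq> A \<triangle> C"
proof -
  have "A \<triangle> C \<subseteq> (A \<triangle> B) \<union> (B \<triangle> C)"
    by auto
  moreover have "card ((A \<triangle> B) \<union> (B \<triangle> C)) \<le> card (A \<triangle> C)"
    using assms(3) card_Un_le[of "A \<triangle> B" "B \<triangle> C"] by linarith
  ultimately have "A \<triangle> C = (A \<triangle> B) \<union> (B \<triangle> C)"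
    using assms(1,2) by (intro card_seteq) auto
  then show ?thesis
    by blast
qed

lemma card_sdiff_eq_1_iff: "card (A \<triangle> B) = 1 \<longleftrightarrow> (\<exists>a. B = A \<triangle> {a})"
  by (metis card_1_singleton_iff One_nat_def sdiff.xor_left_self)

locale cube_labelling = isometric_family "\<phi> ` V"
  for V :: "'a set" and E :: "('a \<times> 'a) set" and \<phi> :: "'a \<Rightarrow> 'b set" +
  assumes inj_label: "inj_on \<phi> V"
    and edge_iff: "(u, v) \<in> E \<longleftrightarrow> u \<in> V \<and> v \<in> V \<and> card (\<phi> u \<triangle> \<phi> v) = 1"
begin

lemma finite_label_sdiff [simp]: "u \<in> V \<Longrightarrow> v \<in> V \<Longrightarrow> finite (\<phi> u \<triangle> \<phi> v)"
  using finite_distance by blast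

lemma label_eq_iff [simp]: "u \<in> V \<Longrightarrow> v \<in> V \<Longrightarrow> \<phi> u = \<phi> v \<longleftrightarrow> u = v"
  using inj_label by (rule inj_on_eq_iff)

lemma edge_iff_step: "(u, v) \<in> E \<longleftrightarrow> u \<in> V \<and> v \<in> V \<and> (\<exists>a. \<phi> v = \<phi> u \<triangle> {a})"
  by (simp only: edge_iff card_sdiff_eq_1_iff)

lemma walk_sdiff_le:
  assumes walk: "is_walk V E p u v" and "i \<le> j" "j < length p"
  shows "card (\<phi> (p ! i) \<triangle> \<phi> (p ! j)) \<le> j - i"
  using assms(2,3)
proof (induction j rule: dec_induct)
  case (step j)
  have "p ! k \<in> V" if "k < length p" for k
    using walk that by (auto simp: is_walk_def dest: nth_mem)
  then have "card (\<phi> (p ! i) \<triangle> \<phi> (p ! Suc j))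
      \<le> card (\<phi> (p ! i) \<triangle> \<phi> (p ! j)) + card (\<phi> (p ! j) \<triangle> \<phi> (p ! Suc j))"
    using step by (intro sdiff_card_triangle) simp_all
  moreover have "(p ! j, p ! Suc j) \<in> E"
    using walk step.prems by (auto simp: is_walk_def)
  ultimately show ?case
    using step by (simp add: edge_iff)
qed simp

lemma ex_geodesic:
  assumes "u \<in> V" "v \<in> V"
  shows "\<exists>p. is_walk V E p u v \<and> length p = Suc (card (\<phi> u \<triangle> \<phi> v))"
proof -
  have "\<phi> u \<in> \<phi> ` V" "\<phi> v \<in> \<phi> ` V"
    using assms by auto
  then show ?thesis
    using assms(1)
  proof (induction "\<phi> u" arbitrary: u rule: geodesic_induct)
    case endpoint
    then have "u = v"
      using assms(2) by simp
    then show ?case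
      using assms(2) by (intro exI[of _ "[v]"]) simp
  next
    case (step a u)
    then obtain w where w: "w \<in> V" "\<phi> w = \<phi> u \<triangle> {a}"
      by auto
    then obtain p where p: "is_walk V E p w v" "length p = Suc (card (\<phi> w \<triangle> \<phi> v))"
      using step by metis
    have "Suc (card (\<phi> w \<triangle> \<phi> v)) = card (\<phi> u \<triangle> \<phi> v)"
      unfolding w(2) sdiff_step[OF step.hyps(2)]
      using step assms(2) by (intro card_Suc_Diff1) auto
    moreover have "(u, w) \<in> E"
      using w step.prems by (auto simp: edge_iff_step)
    moreover obtain q where "p = w # q"
      using p(1) by (cases p) (auto simp: is_walk_def)
    ultimately show ?case
      using p step.prems by (intro exI[of _ "u # p"]) simp
  qed
qed

lemma gdist_eq:
  assumes "u \<in> V" "v \<in> V"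
  shows "gdist V E u v = enat (card (\<phi> u \<triangle> \<phi> v))"
proof (rule antisym)
  show "gdist V E u v \<le> enat (card (\<phi> u \<triangle> \<phi> v))"
    using ex_geodesic[OF assms] by (auto simp: gdist_le_iff)
  have "card (\<phi> u \<triangle> \<phi> v) \<le> length p - 1" if "is_walk V E p u v" for p
    using walk_sdiff_le[OF that, of 0 "length p - 1"] is_walk_ends[OF that] that
    by (simp add: is_walk_def)
  then show "enat (card (\<phi> u \<triangle> \<phi> v)) \<le> gdist V E u v"
    unfolding gdist_def by (intro INF_greatest) simp
qed

lemma ex_shortest_path:
  assumes "u \<in> V" "v \<in> V"
  shows "\<exists>p. shortest_path V E p u v"
  using ex_geodesic[OF assms] gdist_eq[OF assms] by (auto simp: shortest_path_def)

lemma shortest_path_between: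
  assumes "shortest_path V E p u v" "u \<in> V" "v \<in> V" "w \<in> set p"
  shows "\<phi> u \<triangle> \<phi> w \<subseteq> \<phi> u \<triangle> \<phi> v"
proof -
  have walk: "is_walk V E p u v" and len: "length p - 1 = card (\<phi> u \<triangle> \<phi> v)"
    using assms by (auto simp: shortest_path_def gdist_eq)
  obtain i where i: "i < length p" "p ! i = w"
    using assms(4) by (auto simp: in_set_conv_nth)
  have "card (\<phi> u \<triangle> \<phi> w) \<le> i" "card (\<phi> w \<triangle> \<phi> v) \<le> length p - 1 - i"
    using walk_sdiff_le[OF walk, of 0 i] walk_sdiff_le[OF walk, of i "length p - 1"] i
      is_walk_ends[OF walk] by auto
  moreover have "w \<in> V"
    using walk assms(4) by (auto simp: is_walk_def)
  ultimately show ?thesis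
    using len i(1) assms(2,3) by (intro sdiff_subset_if_between) simp_all
qed

lemma convex_subgraph_if_closed_between:
  assumes "C \<subseteq> V"
    and between: "\<And>u v w. u \<in> C \<Longrightarrow> v \<in> C \<Longrightarrow> w \<in> V \<Longrightarrow> \<phi> u \<triangle> \<phi> w \<subseteq> \<phi> u \<triangle> \<phi> v \<Longrightarrow> w \<in> C"
  shows "convex_subgraph C (E \<inter> C \<times> C) V E"
proof -
  have walk: "is_walk C (E \<inter> C \<times> C) p u v"
    if "u \<in> C" "v \<in> C" and p: "shortest_path V E p u v" for u v p
  proof -
    have "is_walk V E p u v"
      using p by (simp add: shortest_path_def)
    moreover have "w \<in> C" if "w \<in> set p" for w
      using between[OF \<open>u \<in> C\<close> \<open>v \<in> C\<close>] shortest_path_between[OF p _ _ that] that \<open>u \<in> C\<close> \<open>v \<in> C\<close>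
        \<open>C \<subseteq> V\<close> \<open>is_walk V E p u v\<close> by (auto simp: is_walk_def)
    ultimately show ?thesis
      by (auto simp: is_walk_def)
  qed
  have sub: "subgraph C (E \<inter> C \<times> C) V E"
    using \<open>C \<subseteq> V\<close> by (auto simp: subgraph_def)
  have "gdist C (E \<inter> C \<times> C) u v = gdist V E u v" if uv: "u \<in> C" "v \<in> C" for u v
  proof (rule antisym)
    obtain p where p: "shortest_path V E p u v"
      using ex_shortest_path uv \<open>C \<subseteq> V\<close> by blast
    then show "gdist C (E \<inter> C \<times> C) u v \<le> gdist V E u v"
      using walk[OF uv p] unfolding gdist_def[of C]
      by (auto simp: shortest_path_def intro: INF_lower2)
  qed (rule gdist_subgraph_ge[OF sub])
  with sub walk show ?thesis
    unfolding convex_subgraph_def isometric_subgraph_def by (auto simp: is_walk_def)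
qed

lemma edge_towards:
  assumes "(u, w) \<in> E" "v \<in> V" and closer: "card (\<phi> w \<triangle> \<phi> v) < card (\<phi> u \<triangle> \<phi> v)"
  shows "\<exists>a\<in>\<phi> u \<triangle> \<phi> v. \<phi> w = \<phi> u \<triangle> {a}"
proof -
  obtain a where "w \<in> V" and a: "\<phi> w = \<phi> u \<triangle> {a}"
    using assms(1) unfolding edge_iff_step by blast
  have "a \<in> \<phi> u \<triangle> \<phi> v"
  proof (rule ccontr)
    assume "a \<notin> \<phi> u \<triangle> \<phi> v"
    then have "\<phi> u \<triangle> \<phi> v \<subseteq> \<phi> w \<triangle> \<phi> v"
      using a by auto
    then have "card (\<phi> u \<triangle> \<phi> v) \<le> card (\<phi> w \<triangle> \<phi> v)"
      using \<open>w \<in> V\<close> \<open>v \<in> V\<close> by (intro card_mono) simp_all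
    with closer show False
      by simp
  qed
  with a show ?thesis
    by blast
qed

lemma isometric_subgraph_labelling:
  assumes isometric: "isometric_subgraph H F V E"
  shows "cube_labelling H F \<phi>"
proof
  have "H \<subseteq> V"
    using isometric by (simp add: isometric_subgraph_def subgraph_def)
  have induced: "F = E \<inter> H \<times> H"
    using isometric by (rule isometric_subgraph_induced) (simp add: edge_iff)
  have dist: "gdist H F u v = enat (card (\<phi> u \<triangle> \<phi> v))" if "u \<in> H" "v \<in> H" for u v
    using that isometric gdist_eq \<open>H \<subseteq> V\<close> by (auto simp: isometric_subgraph_def)
  show "inj_on \<phi> H"
    using inj_label \<open>H \<subseteq> V\<close> by (rule inj_on_subset)
  show "(u, v) \<in> F \<longleftrightarrow> u \<in> H \<and> v \<in> H \<and> card (\<phi> u \<triangle> \<phi> v) = 1" for u v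
    unfolding induced using edge_iff \<open>H \<subseteq> V\<close> by blast
  fix A B assume "A \<in> \<phi> ` H" "B \<in> \<phi> ` H"
  with \<open>H \<subseteq> V\<close> obtain u v where uv: "u \<in> H" "v \<in> H" "v \<in> V" "A = \<phi> u" "B = \<phi> v"
    by blast
  with \<open>H \<subseteq> V\<close> show fin: "finite (A \<triangle> B)"
    using finite_distance by blast
  assume "A \<noteq> B"
  then have "card (A \<triangle> B) \<noteq> 0"
    using fin by simp
  then obtain k where k: "card (A \<triangle> B) = Suc k"
    using not0_implies_Suc by blast
  then obtain w where w: "w \<in> H" "(u, w) \<in> F" "gdist H F w v \<le> enat k"
    using gdist_le_Suc[of H F u v k] dist[of u v] uv \<open>A \<noteq> B\<close> by auto
  then have "(u, w) \<in> E" "card (\<phi> w \<triangle> \<phi> v) < card (\<phi> u \<triangle> \<phi> v)"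
    using dist[of w v] uv k induced by auto
  then have "\<exists>a\<in>A \<triangle> B. \<phi> w = A \<triangle> {a}"
    using edge_towards uv by blast
  with w(1) show "\<exists>a\<in>A \<triangle> B. A \<triangle> {a} \<in> \<phi> ` H"
    by (metis imageI)
qed

lemma card_directions_eq_degree:
  assumes "v \<in> V"
  shows "card (directions (\<phi> ` V) (\<phi> v)) = card {u. (v, u) \<in> E}"
proof -
  have "(\<lambda>a. \<phi> v \<triangle> {a}) ` directions (\<phi> ` V) (\<phi> v) = \<phi> ` {u. (v, u) \<in> E}"
    using assms by (force simp: directions_def edge_iff_step)
  moreover have "inj_on (\<lambda>a. \<phi> v \<triangle> {a}) (directions (\<phi> ` V) (\<phi> v))"
    by (auto simp: inj_on_def)
  moreover have "inj_on \<phi> {u. (v, u) \<in> E}"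
    using inj_label by (rule inj_on_subset) (auto simp: edge_iff)
  ultimately show ?thesis
    by (metis card_image)
qed

end

lemma graph_iso_labelling:
  assumes "graph_iso V E W D" "cube_labelling W D \<psi>" "E \<subseteq> V \<times> V"
  shows "\<exists>\<phi>. cube_labelling V E \<phi> \<and> \<phi> ` V = \<psi> ` W"
proof -
  interpret W: cube_labelling W D \<psi>
    by (rule assms(2))
  obtain f where f: "bij_betw f V W" "\<And>u v. u \<in> V \<Longrightarrow> v \<in> V \<Longrightarrow> (u, v) \<in> E \<longleftrightarrow> (f u, f v) \<in> D"
    using assms(1) by (auto simp: graph_iso_def)
  have image_f: "f ` V = W"
    using f(1) by (simp add: bij_betw_def)
  have image: "(\<psi> \<circ> f) ` V = \<psi> ` W"
    unfolding image_f[symmetric] image_comp ..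
  have "cube_labelling V E (\<psi> \<circ> f)"
    unfolding cube_labelling_def cube_labelling_axioms_def image
  proof (intro conjI allI)
    show "inj_on (\<psi> \<circ> f) V"
      using f(1) W.inj_label image_f by (auto simp: bij_betw_def intro: comp_inj_on)
    show "(u, v) \<in> E \<longleftrightarrow> u \<in> V \<and> v \<in> V \<and> card ((\<psi> \<circ> f) u \<triangle> (\<psi> \<circ> f) v) = 1" for u v
      using f(2)[of u v] assms(3) W.edge_iff[of "f u" "f v"] image_f by auto
  qed (rule W.isometric_family_axioms)
  with image show ?thesis
    by blast
qed

lemma graph_iso_if_label_isometry:
  assumes "cube_labelling V E \<phi>" "cube_labelling W D \<psi>"
    and h: "bij_betw h (\<phi> ` V) (\<psi> ` W)"
    and isometry: "\<And>A B. A \<in> \<phi> ` V \<Longrightarrow> B \<in> \<phi> ` V \<Longrightarrow> card (h A \<triangle> h B) = card (A \<triangle> B)"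
  shows "graph_iso V E W D"
proof -
  interpret V: cube_labelling V E \<phi>
    by (rule assms(1))
  interpret W: cube_labelling W D \<psi>
    by (rule assms(2))
  define f where "f = inv_into W \<psi> \<circ> (h \<circ> \<phi>)"
  have "bij_betw \<phi> V (\<phi> ` V)" "bij_betw \<psi> W (\<psi> ` W)"
    using V.inj_label W.inj_label by (auto simp: bij_betw_def)
  then have f: "bij_betw f V W"
    unfolding f_def using h by (intro bij_betw_trans[OF bij_betw_trans] bij_betw_inv_into)
  have label: "f v \<in> W" "\<psi> (f v) = h (\<phi> v)" if "v \<in> V" for v
  proof -
    show "f v \<in> W"
      using f that by (rule bij_betw_apply)
    have "h (\<phi> v) \<in> \<psi> ` W"
      using h that by (auto simp: bij_betw_def)
    then show "\<psi> (f v) = h (\<phi> v)"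
      by (simp add: f_def f_inv_into_f)
  qed
  have "(u, v) \<in> E \<longleftrightarrow> (f u, f v) \<in> D" if "u \<in> V" "v \<in> V" for u v
    using that isometry label by (simp add: V.edge_iff W.edge_iff)
  with f show ?thesis
    unfolding graph_iso_def by blast
qed

section \<open>Cycle graphs\<close>

lemma cycle_graphI:
  assumes "3 \<le> l" "inj_on g {..<l}" "C = g ` {..<l}" "F \<subseteq> C \<times> C"
    and adj: "\<And>s t. s < l \<Longrightarrow> t < l \<Longrightarrow> (g s, g t) \<in> F \<longleftrightarrow> t = Suc s mod l \<or> s = Suc t mod l"
  shows "cycle_graph C F l"
proof -
  define c where "c = map g [0..<l]"
  have enum: "length c = l" "distinct c" "set c = C" "\<And>i. i < l \<Longrightarrow> c ! i = g i"
    using assms(2,3) by (auto simp: c_def distinct_map lessThan_atLeast0)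
  have next_less: "(i + 1) mod l < l" for i
    using \<open>3 \<le> l\<close> by simp
  have adj_nth: "(c ! s, c ! t) \<in> F \<longleftrightarrow> t = (s + 1) mod l \<or> s = (t + 1) mod l"
    if "s < l" "t < l" for s t
    using adj[OF that] enum(4) that by simp
  have "F = {(c ! i, c ! ((i + 1) mod l)) | i. i < l} \<union> {(c ! ((i + 1) mod l), c ! i) | i. i < l}"
    (is "_ = ?R")
  proof
    show "F \<subseteq> ?R"
    proof
      fix x assume "x \<in> F"
      then obtain s t where x: "x = (c ! s, c ! t)" "s < l" "t < l"
        using assms(4) enum(1,3) by (metis SigmaE2 in_set_conv_nth subsetD surj_pair)
      then have "t = (s + 1) mod l \<or> s = (t + 1) mod l"
        using adj_nth \<open>x \<in> F\<close> by simp
      with x show "x \<in> ?R"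
        by blast
    qed
    show "?R \<subseteq> F"
      using adj_nth[OF _ next_less] adj_nth[OF next_less] by blast
  qed
  then show ?thesis
    unfolding cycle_graph_def using enum(1-3) \<open>3 \<le> l\<close> by blast
qed

lemma cycle_graphE:
  assumes "cycle_graph C F l"
  obtains g where "3 \<le> l" "inj_on g {..<l}" "C = g ` {..<l}"
    "\<And>s t. s < l \<Longrightarrow> t < l \<Longrightarrow> (g s, g t) \<in> F \<longleftrightarrow> t = Suc s mod l \<or> s = Suc t mod l"
proof -
  obtain c where "3 \<le> l" and enum: "length c = l" "distinct c" "C = set c"
    and F_eq: "F = {(c ! i, c ! ((i + 1) mod l)) |i. i < l} \<union>
      {(c ! ((i + 1) mod l), c ! i) |i. i < l}"
    using assms unfolding cycle_graph_def by blast
  have inj: "inj_on ((!) c) {..<l}"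
    using enum by (intro inj_on_nth) auto
  have "C = (!) c ` {..<l}"
    using enum by (auto simp: set_conv_nth)
  moreover have "(c ! s, c ! t) \<in> F \<longleftrightarrow> t = Suc s mod l \<or> s = Suc t mod l" if "s < l" "t < l" for s t
  proof -
    have "Suc i mod l < l" for i
      using \<open>3 \<le> l\<close> by simp
    then show ?thesis
      unfolding F_eq using that enum(1,2) by (auto simp: nth_eq_iff_index_eq)
  qed
  ultimately show thesis
    using that \<open>3 \<le> l\<close> inj by blast
qed

lemma cycle_graph_square:
  assumes "cycle_graph C F l" "{w, x, y, z} \<subseteq> C"
    and "(w, x) \<in> F" "(x, y) \<in> F" "(w, z) \<in> F" "(z, y) \<in> F" "w \<noteq> y" "x \<noteq> z"
  shows "l = 4"
proof -
  obtain g where "3 \<le> l" "inj_on g {..<l}" and C_eq: "C = g ` {..<l}"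
    and adj: "\<And>s t. s < l \<Longrightarrow> t < l \<Longrightarrow> (g s, g t) \<in> F \<longleftrightarrow> t = Suc s mod l \<or> s = Suc t mod l"
    by (rule cycle_graphE[OF assms(1)]) (rule that)
  obtain i j k m where vertices: "w = g i" "x = g j" "y = g k" "z = g m"
    and less: "i < l" "j < l" "k < l" "m < l"
    using assms(2) C_eq by auto
  have succ: "Suc s mod l = (if Suc s = l then 0 else Suc s)" if "s < l" for s
    using that by (simp add: mod_Suc)
  have "i \<noteq> k" "j \<noteq> m"
    using assms(7,8) vertices by auto
  moreover have "j = Suc i mod l \<or> i = Suc j mod l" "k = Suc j mod l \<or> j = Suc k mod l"
    "m = Suc i mod l \<or> i = Suc m mod l" "k = Suc m mod l \<or> m = Suc k mod l"
    using assms(3-6) adj less unfolding vertices by simp_all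
  ultimately show ?thesis
    using less \<open>3 \<le> l\<close> by (auto simp: succ split: if_splits)
qed

context cube_labelling
begin

lemma convex_subcube:
  assumes "C = {w \<in> V. \<phi> u \<triangle> \<phi> w \<subseteq> S}"
  shows "convex_subgraph C (E \<inter> C \<times> C) V E"
proof (rule convex_subgraph_if_closed_between)
  fix a b w assume "a \<in> C" "b \<in> C" "w \<in> V" "\<phi> a \<triangle> \<phi> w \<subseteq> \<phi> a \<triangle> \<phi> b"
  moreover have "\<phi> u \<triangle> \<phi> w \<subseteq> (\<phi> u \<triangle> \<phi> a) \<union> (\<phi> a \<triangle> \<phi> w)"
    "\<phi> a \<triangle> \<phi> b \<subseteq> (\<phi> u \<triangle> \<phi> a) \<union> (\<phi> u \<triangle> \<phi> b)"
    by auto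
  ultimately show "w \<in> C"
    unfolding assms by blast
qed (simp add: assms)

lemma convex_cycle_of_face:
  assumes xs: "distinct xs" "2 \<le> length xs"
    and face: "face (\<phi> ` V) (\<phi> u) (set xs) = cycle_vertices xs"
  shows "\<exists>C F. convex_cycle V E C F (2 * length xs)"
proof -
  define l where "l = 2 * length xs"
  define C where "C = {w \<in> V. \<phi> u \<triangle> \<phi> w \<subseteq> set xs}"
  define g where "g t = inv_into V \<phi> (\<phi> u \<triangle> cycle_vertex xs t)" for t
  have g: "g t \<in> V" "\<phi> (g t) = \<phi> u \<triangle> cycle_vertex xs t" "g t \<in> C" if "t < l" for t
  proof -
    have "cycle_vertex xs t \<in> face (\<phi> ` V) (\<phi> u) (set xs)"
      unfolding face cycle_vertices_def using that by (simp add: l_def)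
    then show "g t \<in> V" "\<phi> (g t) = \<phi> u \<triangle> cycle_vertex xs t" "g t \<in> C"
      by (simp_all add: face_def g_def C_def inv_into_into f_inv_into_f)
  qed
  have "cycle_graph C (E \<inter> C \<times> C) l"
  proof (rule cycle_graphI)
    show "inj_on g {..<l}"
      using inj_on_cycle_vertex[OF xs(1)] g(2)
      by (metis inj_on_def l_def lessThan_iff sdiff_left_cancel)
    show "(g s, g t) \<in> E \<inter> C \<times> C \<longleftrightarrow> t = Suc s mod l \<or> s = Suc t mod l" if "s < l" "t < l" for s t
      using cycle_vertex_adjacent_iff[OF xs, of s t] that g by (simp add: edge_iff l_def)
    show "C = g ` {..<l}"
    proof
      show "C \<subseteq> g ` {..<l}"
      proof
        fix w assume w: "w \<in> C"
        then have "\<phi> u \<triangle> \<phi> w \<in> cycle_vertices xs"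
          unfolding face[symmetric] by (simp add: face_def C_def)
        then obtain t where t: "t < l" "\<phi> u \<triangle> \<phi> w = cycle_vertex xs t"
          by (auto simp: cycle_vertices_def l_def)
        then have "w = g t"
          using w inj_label by (simp add: g_def C_def flip: t(2))
        with t show "w \<in> g ` {..<l}"
          by simp
      qed
    qed (use g in auto)
  qed (use xs(2) in \<open>auto simp: l_def\<close>)
  then show ?thesis
    using convex_subcube[OF C_def] unfolding convex_cycle_def l_def by blast
qed

lemma long_cycle_free_labels:
  assumes "\<And>C F l. convex_cycle V E C F l \<Longrightarrow> l \<le> 4"
  shows "long_cycle_free (\<phi> ` V)"
proof
  fix A xs assume "A \<in> \<phi> ` V" and xs: "distinct xs"
    and face: "face (\<phi> ` V) A (set xs) = cycle_vertices xs"
  then obtain u where "A = \<phi> u"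
    by blast
  show "length xs \<le> 2"
  proof (cases "2 \<le> length xs")
    case True
    then obtain C F where "convex_cycle V E C F (2 * length xs)"
      using convex_cycle_of_face[OF xs] face \<open>A = \<phi> u\<close> by blast
    from assms[OF this] show ?thesis
      by simp
  qed simp
qed

lemma convex_subgraph_square:
  assumes convex: "convex_subgraph C F V E" and edges: "(x, y) \<in> F" "(y, z) \<in> F" and "x \<noteq> z"
    and square: "\<And>A a b. A \<in> \<phi> ` V \<Longrightarrow> A \<triangle> {a} \<in> \<phi> ` V \<Longrightarrow> A \<triangle> {a} \<triangle> {b} \<in> \<phi> ` V \<Longrightarrow>
      A \<triangle> {b} \<in> \<phi> ` V"
  shows "\<exists>w. w \<noteq> y \<and> (x, w) \<in> F \<and> (w, z) \<in> F"
proof -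
  have "F \<subseteq> E" "F \<subseteq> C \<times> C"
    using convex by (auto simp: convex_subgraph_def isometric_subgraph_def subgraph_def)
  then have "(x, y) \<in> E" "(y, z) \<in> E" and in_C: "x \<in> C" "z \<in> C"
    using edges by auto
  then obtain a b where in_V: "x \<in> V" "y \<in> V" "z \<in> V"
    and y: "\<phi> y = \<phi> x \<triangle> {a}" and "\<phi> z = \<phi> y \<triangle> {b}"
    unfolding edge_iff_step by blast
  then have z: "\<phi> z = \<phi> x \<triangle> {a} \<triangle> {b}"
    by simp
  have "\<phi> x \<in> \<phi> ` V" "\<phi> y \<in> \<phi> ` V" "\<phi> z \<in> \<phi> ` V"
    using in_V by simp_all
  then have "\<phi> x \<triangle> {b} \<in> \<phi> ` V"
    unfolding y z by (rule square)
  then obtain w where "w \<in> V" and w: "\<phi> w = \<phi> x \<triangle> {b}"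
    by auto
  have "a \<noteq> b"
    using z label_eq_iff[OF in_V(1,3)] \<open>x \<noteq> z\<close> by (metis sdiff_cancel_right)
  then have "w \<noteq> y"
    using w y by (metis sdiff_left_cancel singleton_inject)
  have "\<phi> x \<triangle> \<phi> z = {a, b}"
    unfolding z sdiff.xor.assoc sdiff.xor_left_self using \<open>a \<noteq> b\<close> by (auto simp: sdiff_singleton)
  then have "(x, z) \<notin> E"
    using \<open>a \<noteq> b\<close> by (simp add: edge_iff)
  have "\<phi> z = \<phi> w \<triangle> {a}"
    unfolding w z by (simp only: sdiff_ac)
  then have "(x, w) \<in> E" "(w, z) \<in> E"
    using \<open>w \<in> V\<close> w in_V by (simp_all only: edge_iff_step) blast+
  with \<open>w \<in> V\<close> \<open>w \<noteq> y\<close> show ?thesis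
    using convex_subgraph_common_neighbour[OF convex in_C \<open>x \<noteq> z\<close> \<open>(x, z) \<notin> E\<close>] by blast
qed

lemma convex_cycle_length_eq_4:
  assumes cycle: "convex_cycle V E C F l"
    and square: "\<And>A a b. A \<in> \<phi> ` V \<Longrightarrow> A \<triangle> {a} \<in> \<phi> ` V \<Longrightarrow> A \<triangle> {a} \<triangle> {b} \<in> \<phi> ` V \<Longrightarrow>
      A \<triangle> {b} \<in> \<phi> ` V"
  shows "l = 4"
proof -
  have cycle_graph: "cycle_graph C F l" and convex: "convex_subgraph C F V E"
    using cycle by (simp_all add: convex_cycle_def)
  obtain g where "3 \<le> l" and inj: "inj_on g {..<l}" and "C = g ` {..<l}"
    and adj: "\<And>s t. s < l \<Longrightarrow> t < l \<Longrightarrow> (g s, g t) \<in> F \<longleftrightarrow> t = Suc s mod l \<or> s = Suc t mod l"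
    by (rule cycle_graphE[OF cycle_graph]) (rule that)
  have edges: "(g 0, g 1) \<in> F" "(g 1, g 2) \<in> F"
    using \<open>3 \<le> l\<close> adj[of 0 1] adj[of 1 2] by auto
  have "g 0 \<noteq> g 2"
    using inj_onD[OF inj, of 0 2] \<open>3 \<le> l\<close> by auto
  with convex edges have "\<exists>w. w \<noteq> g 1 \<and> (g 0, w) \<in> F \<and> (w, g 2) \<in> F"
    using square by (rule convex_subgraph_square)
  then obtain w where "w \<noteq> g 1" "(g 0, w) \<in> F" "(w, g 2) \<in> F"
    by blast
  moreover have "F \<subseteq> C \<times> C"
    using convex by (simp add: convex_subgraph_def isometric_subgraph_def subgraph_def)
  ultimately show ?thesis
    using cycle_graph_square[OF cycle_graph, of "g 0" "g 1" "g 2" w] edges \<open>g 0 \<noteq> g 2\<close> by auto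
qed

end

section \<open>Hypercubes\<close>

definition true_positions :: "bool list \<Rightarrow> nat set" where
  "true_positions bs = {i. i < length bs \<and> bs ! i}"

lemma sdiff_true_positions:
  assumes "length xs = n" "length ys = n"
  shows "true_positions xs \<triangle> true_positions ys = {i. i < n \<and> xs ! i \<noteq> ys ! i}"
  using assms by (auto simp: true_positions_def)

lemma inj_on_true_positions: "inj_on true_positions (cube_V n)"
proof (rule inj_onI)
  fix xs ys assume "xs \<in> cube_V n" "ys \<in> cube_V n" "true_positions xs = true_positions ys"
  then show "xs = ys"
    by (intro nth_equalityI) (auto simp: cube_V_def true_positions_def set_eq_iff)
qed

lemma true_positions_cube_V: "true_positions ` cube_V n = Pow {..<n}"
proof (intro equalityI subsetI)
  fix A assume "A \<in> Pow {..<n}"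
  then have "A = true_positions (map (\<lambda>i. i \<in> A) [0..<n])"
    by (auto simp: true_positions_def)
  then show "A \<in> true_positions ` cube_V n"
    by (rule image_eqI) (simp add: cube_V_def)
qed (auto simp: cube_V_def true_positions_def)

lemma cube_labelling_cube: "cube_labelling (cube_V n) (cube_E n) true_positions"
proof (intro cube_labelling.intro cube_labelling_axioms.intro)
  show "isometric_family (true_positions ` cube_V n)"
    unfolding true_positions_cube_V by (rule isometric_family_Pow) simp
  show "(xs, ys) \<in> cube_E n \<longleftrightarrow>
    xs \<in> cube_V n \<and> ys \<in> cube_V n \<and> card (true_positions xs \<triangle> true_positions ys) = 1" for xs ys
    by (auto simp: cube_E_def cube_V_def sdiff_true_positions)
qed (rule inj_on_true_positions)

lemma partial_cube_labelling:
  assumes "partial_cube V E" "E \<subseteq> V \<times> V"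
  shows "\<exists>\<phi> :: 'a \<Rightarrow> nat set. cube_labelling V E \<phi>"
proof -
  obtain n H F where isometric: "isometric_subgraph H F (cube_V n) (cube_E n)"
    and iso: "graph_iso V E H F"
    using assms(1) by (auto simp: partial_cube_def)
  then have "cube_labelling H F true_positions"
    by (intro cube_labelling.isometric_subgraph_labelling[OF cube_labelling_cube])
  from graph_iso_labelling[OF iso this assms(2)] show ?thesis
    by blast
qed

lemma (in cube_labelling) graph_iso_cube_if_translated_Pow:
  assumes labels: "\<phi> ` V = (\<triangle>) C ` Pow D" and "finite D"
  shows "graph_iso V E (cube_V (card D)) (cube_E (card D))"
proof -
  obtain f where f: "bij_betw f D {..<card D}"
    using ex_bij_betw_finite_nat[OF \<open>finite D\<close>] by (auto simp: lessThan_atLeast0)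
  define h where "h A = f ` (C \<triangle> A)" for A
  have sub: "C \<triangle> A \<subseteq> D" if "A \<in> \<phi> ` V" for A
    using that unfolding labels by simp
  show ?thesis
  proof (rule graph_iso_if_label_isometry[OF cube_labelling_axioms cube_labelling_cube])
    have "bij_betw ((\<triangle>) C) (\<phi> ` V) (Pow D)"
      unfolding labels by (auto simp: bij_betw_def inj_on_def image_image simp del: in_sdiff)
    then have "bij_betw (image f \<circ> (\<triangle>) C) (\<phi> ` V) (Pow {..<card D})"
      using bij_betw_Pow[OF f] by (rule bij_betw_trans)
    then show "bij_betw h (\<phi> ` V) (true_positions ` cube_V (card D))"
      by (simp add: true_positions_cube_V h_def[abs_def] comp_def)
    show "card (h A \<triangle> h B) = card (A \<triangle> B)" if AB: "A \<in> \<phi> ` V" "B \<in> \<phi> ` V" for A B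
    proof -
      have "inj_on f ((C \<triangle> A) \<union> (C \<triangle> B))"
        using f sub[OF AB(1)] sub[OF AB(2)] by (auto simp: bij_betw_def intro: inj_on_subset)
      then show ?thesis
        by (simp add: h_def card_image_sdiff)
    qed
  qed
qed

lemma (in cube_labelling) regular_imp_cube:
  assumes "finite V" "v \<in> V" and regular: "\<And>v. v \<in> V \<Longrightarrow> card {u. (v, u) \<in> E} = d"
    and "\<And>C F l. convex_cycle V E C F l \<Longrightarrow> l \<le> 4"
  shows "graph_iso V E (cube_V d) (cube_E d)"
proof -
  interpret long_cycle_free "\<phi> ` V"
    using assms(4) by (rule long_cycle_free_labels)
  interpret regular_long_cycle_free "\<phi> ` V" d
    by unfold_locales (use \<open>finite V\<close> regular card_directions_eq_degree in auto)
  have "\<phi> ` V = (\<triangle>) (\<phi> v) ` Pow (directions (\<phi> ` V) (\<phi> v))"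
    using \<open>v \<in> V\<close> by (intro family_eq_translated_Pow) simp
  from graph_iso_cube_if_translated_Pow[OF this finite_directions[OF finite_family]]
  show ?thesis
    using regular_family \<open>v \<in> V\<close> by simp
qed

lemma convex_cycle_length_if_cube:
  assumes "graph_iso V E (cube_V k) (cube_E k)" "E \<subseteq> V \<times> V" "convex_cycle V E C F l"
  shows "l = 4"
proof -
  obtain \<phi> where \<phi>: "cube_labelling V E \<phi>" "\<phi> ` V = Pow {..<k}"
    using graph_iso_labelling[OF assms(1) cube_labelling_cube assms(2)] true_positions_cube_V
    by metis
  show ?thesis
  proof (rule cube_labelling.convex_cycle_length_eq_4[OF \<phi>(1) assms(3)], unfold \<phi>(2))
    fix A a b assume "A \<in> Pow {..<k}" "A \<triangle> {a} \<in> Pow {..<k}" "A \<triangle> {a} \<triangle> {b} \<in> Pow {..<k}"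
    moreover have "A \<triangle> {b} \<subseteq> A \<union> (A \<triangle> {a}) \<union> (A \<triangle> {a} \<triangle> {b})"
      by auto
    ultimately show "A \<triangle> {b} \<in> Pow {..<k}"
      by blast
  qed
qed

lemma graph_iso_trans:
  assumes "graph_iso V E W D" "graph_iso W D X F"
  shows "graph_iso V E X F"
proof -
  obtain f where f: "bij_betw f V W" "\<forall>u\<in>V. \<forall>v\<in>V. (u, v) \<in> E \<longleftrightarrow> (f u, f v) \<in> D"
    using assms(1) unfolding graph_iso_def by blast
  obtain g where g: "bij_betw g W X" "\<forall>u\<in>W. \<forall>v\<in>W. (u, v) \<in> D \<longleftrightarrow> (g u, g v) \<in> F"
    using assms(2) unfolding graph_iso_def by blast
  have "(u, v) \<in> E \<longleftrightarrow> ((g \<circ> f) u, (g \<circ> f) v) \<in> F" if "u \<in> V" "v \<in> V" for u v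
    using that f g by (auto simp: bij_betw_def)
  then show ?thesis
    using bij_betw_trans[OF f(1) g(1)] unfolding graph_iso_def by blast
qed

lemma graph_iso_cube_0: "graph_iso (cube_V 0) (cube_E 0) (K_V 1) (K_E 1)"
  unfolding graph_iso_def
  by (rule exI[of _ "\<lambda>_. 0"]) (auto simp: bij_betw_def cube_V_def cube_E_def K_V_def K_E_def)

lemma graph_iso_cube_1: "graph_iso (cube_V 1) (cube_E 1) (K_V 2) (K_E 2)"
proof -
  let ?f = "\<lambda>bs. if bs ! 0 then 1 else 0 :: nat"
  have cube_V_1: "cube_V 1 = {[True], [False]}"
    by (auto simp: cube_V_def length_Suc_conv)
  have edge_iff: "(xs, ys) \<in> cube_E 1 \<longleftrightarrow> xs ! 0 \<noteq> ys ! 0"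
    if "xs \<in> cube_V 1" "ys \<in> cube_V 1" for xs ys
  proof -
    have "{i. i < 1 \<and> xs ! i \<noteq> ys ! i} = (if xs ! 0 \<noteq> ys ! 0 then {0} else {})"
      by auto
    with that show ?thesis
      by (simp add: cube_E_def cube_V_def)
  qed
  have "bij_betw ?f (cube_V 1) (K_V 2)"
    unfolding cube_V_1 K_V_def by (auto simp: bij_betw_def)
  moreover have "\<forall>u\<in>cube_V 1. \<forall>v\<in>cube_V 1. (u, v) \<in> cube_E 1 \<longleftrightarrow> (?f u, ?f v) \<in> K_E 2"
    using edge_iff by (auto simp: K_E_def)
  ultimately show ?thesis
    unfolding graph_iso_def by blast
qed

theorem theorem1p1:
  fixes V :: "'a set" and E :: "('a \<times> 'a) set"
  assumes "finite_graph V E"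
    and "partial_cube V E"
    and "regular V E"
    and "\<not> graph_iso V E (K_V 1) (K_E 1)"
    and "\<not> graph_iso V E (K_V 2) (K_E 2)"
  shows "(\<forall>C F l. convex_cycle V E C F l \<longrightarrow> l = 4) \<longleftrightarrow>
         (\<exists>k\<ge>2. graph_iso V E (cube_V k) (cube_E k))"
proof -
  have E_subset: "E \<subseteq> V \<times> V" and "finite V" "V \<noteq> {}"
    using assms(1) by (auto simp: finite_graph_def simple_graph_def)
  show ?thesis
  proof
    assume "\<forall>C F l. convex_cycle V E C F l \<longrightarrow> l = 4"
    moreover obtain \<phi> :: "'a \<Rightarrow> nat set" where "cube_labelling V E \<phi>"
      using partial_cube_labelling[OF assms(2) E_subset] by blast
    moreover obtain v where "v \<in> V"
      using \<open>V \<noteq> {}\<close> by blast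
    moreover obtain d where "\<And>v. v \<in> V \<Longrightarrow> card {u. (v, u) \<in> E} = d"
      using assms(3) by (auto simp: regular_def)
    ultimately have cube: "graph_iso V E (cube_V d) (cube_E d)"
      using \<open>finite V\<close> by (intro cube_labelling.regular_imp_cube) auto
    have "d \<noteq> 0" "d \<noteq> 1"
      using cube assms(4,5) graph_iso_trans[OF _ graph_iso_cube_0]
        graph_iso_trans[OF _ graph_iso_cube_1] by metis+
    then show "\<exists>k\<ge>2. graph_iso V E (cube_V k) (cube_E k)"
      using cube by (intro exI[of _ d]) simp
  qed (use convex_cycle_length_if_cube E_subset in blast)
qed

end
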